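(* Fix a real number $\kappa>0$. Suppose $\Gamma=\operatorname{Cay}(G,S)$ is a strongly connected Cayley digraph of a finite abelian group $G$ on $n=|G|$ vertices (ranging over a family with $n\to\infty$) with out-degree $d=|S|$ satisfying $$ d\le\frac{\log n}{\kappa\log\log n} $$ for all sufficiently large $n$. Then for every integer $s\ge 1$, $$ c_{1,s}(\Gamma)\le c_{1,\infty}(\Gamma)=O\left(\frac{n}{(\log n)^{\kappa}}\right). $$ If $S=-S$, the denominator improves to $(\log n)^{2\kappa}$, i.e. $c_{1,s}(\Gamma)\le c_{1,\infty}(\Gamma)=O\left(\frac{n}{(\log n)^{2\kappa}}\right)$.
   Context: Cayley digraphs: $G$ is a nontrivial finite abelian group written additively ($|G|\ge 2$), $S\subseteq G\setminus\{0\}$, and $\operatorname{Cay}(G,S)$ is the digraph with vertex set $G$ and an arc $x\to x+g$ for every $x\in G$, $g\in S$. It is strongly connected if and only if $S$ generates $G$. When $S=-S$ it is regarded as an undirected graph; an undirected graph is identified with the symmetric digraph obtained by replacing each edge by two opposite arcs. Logarithms are natural. The game on a finite digraph $\Gamma$ with speed-$1$ cops and a speed-$s$ robber: the cops choose their initial vertices first, then the robber chooses its initial vertex. Thereafter players alternate, the cops moving first in each round. On the cops' move each cop may remain where it is or move along one arc. On the robber's move, the robber may remain where it is or move along a directed path of length at most $s$ no vertex of which (including the terminal vertex) is occupied by a cop. A directed path is a vertex sequence without repetition whose consecutive vertices are joined by arcs in the forward direction; its length is its number of arcs. Capture occurs as soon as a cop and the robber occupy the same vertex. $c_{1,s}(\Gamma)$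 is the least number of speed-$1$ cops that guarantee capture of a speed-$s$ robber. $c_{1,\infty}(\Gamma)$ is the corresponding number when the robber may traverse any finite cop-free directed path (of arbitrary length) in one turn. Asymptotic notation is as $n\to\infty$: $O(f(n))$ means at most $Cf(n)$ for all $n\ge n_0$, where the constants $C,n_0$ do not depend on $n$ or $s$ ($\kappa$ being fixed). *)

theory Defs
  imports
    Complex_Main
    "HOL-Library.Extended_Nat"
    "HOL-Algebra.Coset"
    "Graph_Theory.Graph_Theory"
begin

text \<open>
  Groups are written multiplicatively, as in HOL-Algebra: \<open>x \<otimes> g\<close> is the \<open>x + g\<close> of additive
  notation, \<open>\<one>\<close> is \<open>0\<close>, and \<open>inv g\<close> is \<open>- g\<close>.
\<close>

definition Cay :: "'a monoid \<Rightarrow> 'a set \<Rightarrow> 'a pair_pre_digraph" where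
  "Cay G S = \<lparr> pverts = carrier G, parcs = {(x, x \<otimes>\<^bsub>G\<^esub> g) | x g. x \<in> carrier G \<and> g \<in> S} \<rparr>"

definition abelian_cayley_datum :: "'a monoid \<Rightarrow> 'a set \<Rightarrow> bool" where
  "abelian_cayley_datum G S \<longleftrightarrow>
     comm_group G \<and> finite (carrier G) \<and> 2 \<le> order G \<and> S \<subseteq> carrier G - {\<one>\<^bsub>G\<^esub>}"

text \<open>
  The list \<open>c\<close> records the position of every cop, so several cops may share a vertex.
\<close>

definition cop_move :: "('a, 'b) pre_digraph \<Rightarrow> 'a list \<Rightarrow> 'a list \<Rightarrow> bool" where
  "cop_move \<Gamma> c c' \<longleftrightarrow> list_all2 (\<lambda>u v. v = u \<or> (u, v) \<in> arcs_ends \<Gamma>) c c'"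

text \<open>
  The speed \<open>s\<close> is an extended natural number; at \<open>s = \<infinity>\<close> the length of the path is unrestricted.
\<close>

definition robber_move ::
  "('a, 'b) pre_digraph \<Rightarrow> enat \<Rightarrow> 'a list \<Rightarrow> 'a \<Rightarrow> 'a \<Rightarrow> bool" where
  "robber_move \<Gamma> s c r r' \<longleftrightarrow>
     r' = r \<or>
     (\<exists>p. vpath p \<Gamma> \<and> hd p = r \<and> last p = r' \<and> enat (vwalk_length p) \<le> s \<and> set p \<inter> set c = {})"

text \<open>
  A strategy maps the list of robber positions seen so far, oldest first, to the next cop
  positions: \<open>\<sigma> []\<close> is the initial placement, chosen before the robber's, and
  \<open>\<sigma> [r\<^sub>0, \<dots>, r\<^sub>t]\<close> is the placement after the cops' move of round \<open>t\<close> (counted from \<open>0\<close>).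
\<close>

definition cop_strategy ::
  "('a, 'b) pre_digraph \<Rightarrow> nat \<Rightarrow> ('a list \<Rightarrow> 'a list) \<Rightarrow> bool" where
  "cop_strategy \<Gamma> k \<sigma> \<longleftrightarrow>
     length (\<sigma> []) = k \<and> set (\<sigma> []) \<subseteq> verts \<Gamma> \<and>
     (\<forall>h \<in> lists (verts \<Gamma>). \<forall>x \<in> verts \<Gamma>. cop_move \<Gamma> (\<sigma> h) (\<sigma> (h @ [x])))"

text \<open>
  Plays are continued formally after a capture. This does not affect which strategies win,
  because the robber may always stay put, so every finished play has an infinite continuation.
\<close>

definition robber_play ::
  "('a, 'b) pre_digraph \<Rightarrow> enat \<Rightarrow> ('a list \<Rightarrow> 'a list) \<Rightarrow> (nat \<Rightarrow> 'a) \<Rightarrow> bool" where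
  "robber_play \<Gamma> s \<sigma> r \<longleftrightarrow>
     r 0 \<in> verts \<Gamma> \<and> (\<forall>t. robber_move \<Gamma> s (\<sigma> (map r [0..<Suc t])) (r t) (r (Suc t)))"

text \<open>
  The robber at \<open>r t\<close> can share a vertex with a cop before the cops' move of round \<open>t\<close>
  (positions \<open>\<sigma> [r 0, \<dots>, r (t - 1)]\<close>) or after it (positions \<open>\<sigma> [r 0, \<dots>, r t]\<close>).
\<close>

definition captured :: "('a list \<Rightarrow> 'a list) \<Rightarrow> (nat \<Rightarrow> 'a) \<Rightarrow> bool" where
  "captured \<sigma> r \<longleftrightarrow>
     (\<exists>t. r t \<in> set (\<sigma> (map r [0..<t])) \<or> r t \<in> set (\<sigma> (map r [0..<Suc t])))"

definition cops_win :: "('a, 'b) pre_digraph \<Rightarrow> enat \<Rightarrow> nat \<Rightarrow> bool" where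
  "cops_win \<Gamma> s k \<longleftrightarrow>
     (\<exists>\<sigma>. cop_strategy \<Gamma> k \<sigma> \<and> (\<forall>r. robber_play \<Gamma> s \<sigma> r \<longrightarrow> captured \<sigma> r))"

text \<open>
  On a finite digraph the minimum exists: with one cop on every vertex the robber is caught at once.
\<close>

definition cop_number :: "('a, 'b) pre_digraph \<Rightarrow> enat \<Rightarrow> nat" where
  "cop_number \<Gamma> s = (LEAST k. cops_win \<Gamma> s k)"

end

theory Submission
  imports Defs "HOL-Library.Multiset_Order" "HOL-Algebra.FiniteProduct"
begin

text \<open>
  Layer the vertices by their distance from a subgroup \<open>H\<close>. An arc climbs at most one layer, so
  cops on a whole layer confine the robber below it, and two teams alternating between consecutive
  layers push the robber down until it is caught. Hence twice the largest layer many cops suffice.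

  To bound a layer, represent each coset of \<open>H\<close> by its least shortest multiset of generators. The
  representatives are closed under removing elements, and counting the removals with multiplicity
  gives \<open>(r + d) \<bar>sphere r\<bar> \<le> d \<bar>ball r\<bar>\<close> for \<open>d\<close> generators. Combined with
  \<open>\<bar>ball r\<bar> \<le> C\<^sup>p (r + p choose r)\<close> this bounds every sphere by a constant times
  \<open>N\<^bsup>1 - 1/p\<^esup>\<close>, where \<open>N\<close> is the index of \<open>H\<close>. In general \<open>H\<close> is trivial and
  \<open>p = d\<close>; if \<open>S = - S\<close>, then \<open>H\<close> is generated by the involutions in \<open>S\<close> and \<open>p = d div 2\<close>, since
  a shortest representative never uses both a generator and its inverse.
\<close>

section \<open>Sweeping a digraph layer by layer\<close>

text \<open>\<open>clearing \<Gamma> s c R\<close>: with the cops on \<open>c\<close> and to move, finitely many moves that do not depend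
  on the robber catch every robber that is currently somewhere in \<open>R\<close>.\<close>

inductive clearing ::
  "('a, 'b) pre_digraph \<Rightarrow> enat \<Rightarrow> 'a list \<Rightarrow> 'a set \<Rightarrow> bool" for \<Gamma> s where
  clearing_empty: "clearing \<Gamma> s c {}"
| clearing_step: "cop_move \<Gamma> c c' \<Longrightarrow>
    (\<And>r r'. r \<in> R - set c' \<Longrightarrow> robber_move \<Gamma> s c' r r' \<Longrightarrow> r' \<in> R') \<Longrightarrow>
    clearing \<Gamma> s c' R' \<Longrightarrow> clearing \<Gamma> s c R"

lemma cop_move_refl: "cop_move \<Gamma> c c"
  by (simp add: cop_move_def list_all2_same)

text \<open>Unrolls the inductive predicate into an infinite sequence of placements, shifted by one
  at each \<open>clearing_step\<close>. In the empty case the sequence may stay constant, since no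
  \<open>r 0\<close> lies in the empty set.\<close>

lemma clearing_imp_schedule:
  assumes "clearing \<Gamma> s c R"
  shows "\<exists>pos. pos 0 = c \<and> (\<forall>t. cop_move \<Gamma> (pos t) (pos (Suc t))) \<and>
    (\<forall>r. r 0 \<in> R \<longrightarrow> (\<forall>t. robber_move \<Gamma> s (pos (Suc t)) (r t) (r (Suc t))) \<longrightarrow>
      (\<exists>t. r t \<in> set (pos (Suc t))))"
  using assms
proof induction
  case (clearing_empty c)
  then show ?case by (intro exI[of _ "\<lambda>_. c"]) (simp add: cop_move_refl)
next
  case (clearing_step c c' R R')
  then obtain pos where pos: "pos 0 = c'" "\<And>t. cop_move \<Gamma> (pos t) (pos (Suc t))"
    and win: "\<And>r. r 0 \<in> R' \<Longrightarrow> (\<forall>t. robber_move \<Gamma> s (pos (Suc t)) (r t) (r (Suc t))) \<Longrightarrow>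
      \<exists>t. r t \<in> set (pos (Suc t))"
    by blast
  define pos' where "pos' = case_nat c pos"
  have "cop_move \<Gamma> (pos' t) (pos' (Suc t))" for t
    using clearing_step.hyps(1) pos by (cases t) (auto simp: pos'_def)
  moreover have "\<exists>t. r t \<in> set (pos' (Suc t))"
    if r0: "r 0 \<in> R" and mv: "\<forall>t. robber_move \<Gamma> s (pos' (Suc t)) (r t) (r (Suc t))" for r
  proof (cases "r 0 \<in> set c'")
    case True
    then show ?thesis using pos by (auto simp: pos'_def intro!: exI[of _ 0])
  next
    case False
    have "robber_move \<Gamma> s c' (r 0) (r 1)"
      using mv[rule_format, of 0] pos by (simp add: pos'_def)
    with False r0 have "r 1 \<in> R'" using clearing_step.hyps(2) by blast
    moreover have "robber_move \<Gamma> s (pos (Suc t)) (r (Suc t)) (r (Suc (Suc t)))" for t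
      using mv[rule_format, of "Suc t"] by (simp add: pos'_def)
    ultimately obtain t where "r (Suc t) \<in> set (pos (Suc t))"
      using win[of "\<lambda>t. r (Suc t)"] by auto
    then show ?thesis by (auto simp: pos'_def intro!: exI[of _ "Suc t"])
  qed
  ultimately show ?case by (intro exI[of _ pos']) (auto simp: pos'_def)
qed

text \<open>The schedule does not depend on the robber, so the strategy reads only the length of the
  history: after \<open>t\<close> observed positions the cops stand on \<open>pos t\<close>.\<close>

lemma clearing_imp_cops_win:
  assumes "clearing \<Gamma> s c (verts \<Gamma>)" "set c \<subseteq> verts \<Gamma>"
  shows "cops_win \<Gamma> s (length c)"
proof -
  obtain pos where pos: "pos 0 = c" "\<And>t. cop_move \<Gamma> (pos t) (pos (Suc t))"
    and win: "\<And>r. r 0 \<in> verts \<Gamma> \<Longrightarrow>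
      (\<forall>t. robber_move \<Gamma> s (pos (Suc t)) (r t) (r (Suc t))) \<Longrightarrow> \<exists>t. r t \<in> set (pos (Suc t))"
    using clearing_imp_schedule[OF assms(1)] by blast
  show ?thesis
    unfolding cops_win_def cop_strategy_def robber_play_def captured_def
  proof (intro exI[of _ "\<lambda>h. pos (length h)"] conjI allI impI)
    fix r
    assume "r 0 \<in> verts \<Gamma> \<and>
      (\<forall>t. robber_move \<Gamma> s (pos (length (map r [0..<Suc t]))) (r t) (r (Suc t)))"
    then obtain t where "r t \<in> set (pos (Suc t))"
      using win[of r] by auto
    then show "\<exists>t. r t \<in> set (pos (length (map r [0..<t]))) \<or>
        r t \<in> set (pos (length (map r [0..<Suc t])))"
      by auto
  qed (use pos assms(2) in auto)
qed

text \<open>Ensures that some number of cops wins, so that the \<open>LEAST\<close> in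
  \<open>cop_number\<close> is attained.\<close>

lemma cops_win_on_all_verts:
  assumes "finite (verts \<Gamma>)"
  shows "cops_win \<Gamma> s (card (verts \<Gamma>))"
proof -
  obtain xs where xs: "set xs = verts \<Gamma>" "length xs = card (verts \<Gamma>)"
    using finite_distinct_list[OF assms] distinct_card by metis
  show ?thesis
    unfolding cops_win_def cop_strategy_def robber_play_def captured_def
    by (rule exI[of _ "\<lambda>_. xs"]) (use xs in \<open>auto simp: cop_move_refl\<close>)
qed

section \<open>Dependence on the robber's speed\<close>

lemma robber_move_mono:
  "robber_move \<Gamma> s c r r' \<Longrightarrow> s \<le> s' \<Longrightarrow> robber_move \<Gamma> s' c r r'"
  unfolding robber_move_def by (metis order_trans)

lemma cops_win_antimono_speed:
  "cops_win \<Gamma> s' k \<Longrightarrow> s \<le> s' \<Longrightarrow> cops_win \<Gamma> s k"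
  unfolding cops_win_def robber_play_def by (meson robber_move_mono)

lemma cop_number_mono_speed:
  assumes "finite (verts \<Gamma>)" "s \<le> s'"
  shows "cop_number \<Gamma> s \<le> cop_number \<Gamma> s'"
  unfolding cop_number_def
  by (rule Least_le, rule cops_win_antimono_speed[OF _ assms(2)],
      rule LeastI, rule cops_win_on_all_verts[OF assms(1)])

text \<open>A discrete intermediate value argument: levels may drop freely but rise by at most one
  per arc, so a walk starting below \<open>l\<close> cannot get above it without visiting level
  \<open>l\<close>.\<close>

lemma vwalk_stays_below:
  fixes f :: "'a \<Rightarrow> nat"
  assumes "vwalk p \<Gamma>" "\<And>u v. (u, v) \<in> arcs_ends \<Gamma> \<Longrightarrow> f v \<le> Suc (f u)"
    and "f (hd p) < l" "\<And>v. v \<in> set p \<Longrightarrow> f v \<noteq> l"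
  shows "f (last p) < l"
  using assms
proof (induction p rule: vwalk_arcs.induct)
  case (3 x y es)
  then have "f y < l"
    by (force simp: vwalk_def)
  with 3 show ?case by (simp add: vwalk_def)
qed (auto simp: vwalk_def)

lemma robber_move_stays_below:
  fixes f :: "'a \<Rightarrow> nat"
  assumes "robber_move \<Gamma> s c r r'" "\<And>u v. (u, v) \<in> arcs_ends \<Gamma> \<Longrightarrow> f v \<le> Suc (f u)"
    and "f r < l" "{v \<in> verts \<Gamma>. f v = l} \<subseteq> set c" "r \<in> verts \<Gamma>"
  shows "r' \<in> {v \<in> verts \<Gamma>. f v < l}"
  using assms(1) unfolding robber_move_def
proof (elim disjE exE conjE)
  fix p assume p: "vpath p \<Gamma>" "hd p = r" "last p = r'" "set p \<inter> set c = {}"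
  then have "vwalk p \<Gamma>" "set p \<subseteq> verts \<Gamma>" by (auto simp: vpath_def vwalk_def)
  moreover have "r' \<in> set p" using p by (auto simp: vpath_def vwalk_def)
  ultimately show ?thesis
    using vwalk_stays_below[of p \<Gamma> f l] assms p by blast
qed (use assms in auto)

section \<open>Walking a team of cops to a new placement\<close>

lemma listrel1_imp_cop_move:
  "(b, b') \<in> listrel1 (arcs_ends \<Gamma>) \<Longrightarrow> cop_move \<Gamma> b b'"
  unfolding cop_move_def
  by (auto elim!: listrel1E intro!: list_all2_appendI simp: list_all2_same)

lemma cop_move_append:
  "cop_move \<Gamma> a a' \<Longrightarrow> cop_move \<Gamma> b b' \<Longrightarrow> cop_move \<Gamma> (a @ b) (a' @ b')"
  by (simp add: cop_move_def list_all2_appendI)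

text \<open>The cops walk one at a time: \<open>listrel1\<close> moves a single entry along one arc,
  and componentwise reachability decomposes into such moves.\<close>

lemma team_walk:
  assumes "strongly_connected \<Gamma>" "set b \<subseteq> verts \<Gamma>" "set b' \<subseteq> verts \<Gamma>" "length b = length b'"
  shows "(b, b') \<in> (listrel1 (arcs_ends \<Gamma>))\<^sup>*"
proof -
  have "(u, v) \<in> (arcs_ends \<Gamma>)\<^sup>*" if uv: "u \<in> verts \<Gamma>" "v \<in> verts \<Gamma>" for u v
  proof -
    have "(u, v) \<in> rtrancl_on (verts \<Gamma>) (arcs_ends \<Gamma>)"
      using assms(1) uv by (auto simp: strongly_connected_def reachable_def)
    then show ?thesis by induction auto
  qed
  then have "(b, b') \<in> listrel ((arcs_ends \<Gamma>)\<^sup>*)"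
    using assms(2-4) unfolding listrel_iff_nth by (metis nth_mem subsetD)
  then show ?thesis by (simp add: listrel_rtrancl_eq_rtrancl_listrel1)
qed

text \<open>The two teams keep their places in the list of cops while their roles alternate: \<open>app\<close> records
  whether the holding team \<open>a\<close> is its first or its second half.\<close>

lemma clearing_team_walk:
  fixes f :: "'a \<Rightarrow> nat"
  assumes lev: "\<And>u v. (u, v) \<in> arcs_ends \<Gamma> \<Longrightarrow> f v \<le> Suc (f u)"
    and walk: "(b, b') \<in> (listrel1 (arcs_ends \<Gamma>))\<^sup>*"
    and app: "app = (@) \<or> app = (\<lambda>a b. b @ a)"
    and guard: "{v \<in> verts \<Gamma>. f v = l} \<subseteq> set a"
    and clr: "clearing \<Gamma> s (app a b') {v \<in> verts \<Gamma>. f v < l}"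
  shows "clearing \<Gamma> s (app a b) {v \<in> verts \<Gamma>. f v < l}"
  using walk
proof (induction rule: converse_rtrancl_induct)
  case base
  then show ?case by (rule clr)
next
  case (step b b1)
  have "cop_move \<Gamma> (app a b) (app a b1)"
    using app listrel1_imp_cop_move[OF step.hyps(1)]
    by (elim disjE) (simp_all add: cop_move_append cop_move_refl)
  moreover have sub: "set a \<subseteq> set (app a b1)" using app by auto
  have "r' \<in> {v \<in> verts \<Gamma>. f v < l}"
    if "r \<in> {v \<in> verts \<Gamma>. f v < l} - set (app a b1)" "robber_move \<Gamma> s (app a b1) r r'" for r r'
    by (rule robber_move_stays_below[OF that(2)]) (use lev guard that(1) sub in auto)
  ultimately show ?case
    using step.IH by (blast intro: clearing_step)
qed

text \<open>Surplus cops are parked on an arbitrary vertex, so a team has exactly \<open>K\<close>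
  members whatever the size of the layer it covers.\<close>

lemma obtain_cover:
  assumes "L \<subseteq> V" "finite V" "V \<noteq> {}" "card L \<le> K"
  obtains xs where "length xs = K" "L \<subseteq> set xs" "set xs \<subseteq> V"
proof -
  obtain ys where ys: "set ys = L" "length ys = card L"
    using finite_distinct_list distinct_card assms finite_subset by metis
  obtain v where "v \<in> V" using assms by blast
  with ys assms show ?thesis
    by (intro that[of "ys @ replicate (K - card L) v"]) auto
qed

text \<open>Arcs raise the level by at most one, so cops on all of level \<open>l\<close> confine a robber below it;
  one team holds level \<open>l + 1\<close> while the other walks to level \<open>l\<close>.\<close>

lemma clearing_levels:
  fixes f :: "'a \<Rightarrow> nat"
  assumes lev: "\<And>u v. (u, v) \<in> arcs_ends \<Gamma> \<Longrightarrow> f v \<le> Suc (f u)"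
    and con: "strongly_connected \<Gamma>" and fin: "finite (verts \<Gamma>)"
    and K: "\<And>l. card {v \<in> verts \<Gamma>. f v = l} \<le> K"
    and "app = (@) \<or> app = (\<lambda>a b. b @ a)"
    and "set a \<subseteq> verts \<Gamma>" "length a = K" and "set b \<subseteq> verts \<Gamma>" "length b = K"
    and "{v \<in> verts \<Gamma>. f v = l} \<subseteq> set a"
  shows "clearing \<Gamma> s (app a b) {v \<in> verts \<Gamma>. f v < l}"
  using assms(5-)
proof (induction l arbitrary: a b app)
  case 0
  then show ?case by (simp add: clearing_empty)
next
  case (Suc l)
  obtain b' where b': "length b' = K" "{v \<in> verts \<Gamma>. f v = l} \<subseteq> set b'" "set b' \<subseteq> verts \<Gamma>"
    using obtain_cover[of "{v \<in> verts \<Gamma>. f v = l}" "verts \<Gamma>" K] fin K con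
    by (auto simp: strongly_connected_def)
  \<comment> \<open>Team \<open>b'\<close> now holds level \<open>l\<close> and \<open>a\<close>
    becomes the walking team; swapping the arguments of \<open>app\<close> leaves every cop at its
    place in the list.\<close>
  define app' where "app' = (\<lambda>a b. app b a :: 'a list)"
  have "clearing \<Gamma> s (app' b' a) {v \<in> verts \<Gamma>. f v < l}"
    using Suc.prems b' by (intro Suc.IH) (auto simp: app'_def)
  then have sub: "clearing \<Gamma> s (app a b') {v \<in> verts \<Gamma>. f v < l}"
    by (simp add: app'_def)
  have cov: "set b' \<subseteq> set (app a b')" using Suc.prems(1) by auto
  \<comment> \<open>One round of waiting: a robber on level \<open>l\<close> stands on a cop, and
    any other robber is already confined below \<open>l\<close>.\<close>
  have "clearing \<Gamma> s (app a b') {v \<in> verts \<Gamma>. f v < Suc l}"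
  proof (rule clearing_step[OF cop_move_refl _ sub])
    fix r r'
    assume r: "r \<in> {v \<in> verts \<Gamma>. f v < Suc l} - set (app a b')"
      and mv: "robber_move \<Gamma> s (app a b') r r'"
    have "f r \<noteq> l" using r cov b' by blast
    with r have "f r < l" "r \<in> verts \<Gamma>" by auto
    with cov b' show "r' \<in> {v \<in> verts \<Gamma>. f v < l}"
      by (intro robber_move_stays_below[OF mv lev]) auto
  qed
  moreover have "(b, b') \<in> (listrel1 (arcs_ends \<Gamma>))\<^sup>*"
    using team_walk[OF con] Suc.prems b' by simp
  ultimately show ?case
    using clearing_team_walk[of \<Gamma> f b b' app "Suc l" a s] lev Suc.prems by blast
qed

lemma cops_win_levels:
  fixes f :: "'a \<Rightarrow> nat"
  assumes lev: "\<And>u v. (u, v) \<in> arcs_ends \<Gamma> \<Longrightarrow> f v \<le> Suc (f u)"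
    and con: "strongly_connected \<Gamma>" and fin: "finite (verts \<Gamma>)"
    and K: "\<And>l. card {v \<in> verts \<Gamma>. f v = l} \<le> K"
  shows "cops_win \<Gamma> s (2 * K)"
proof -
  obtain l where l: "\<And>v. v \<in> verts \<Gamma> \<Longrightarrow> f v < l"
    using finite_nat_set_iff_bounded[of "f ` verts \<Gamma>"] fin by auto
  obtain a where a: "length a = K" "set a \<subseteq> verts \<Gamma>"
    using obtain_cover[of "{}" "verts \<Gamma>" K] fin con by (auto simp: strongly_connected_def)
  \<comment> \<open>Level \<open>l\<close> lies above all vertices, so it is empty and any placement
    guards it.\<close>
  have "{v \<in> verts \<Gamma>. f v = l} \<subseteq> set a" "{v \<in> verts \<Gamma>. f v < l} = verts \<Gamma>"
    using l by fastforce+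
  then have "clearing \<Gamma> s (a @ a) (verts \<Gamma>)"
    using clearing_levels[of \<Gamma> f K "(@)" a a l s] assms a by simp
  from clearing_imp_cops_win[OF this] a show ?thesis by (simp add: mult_2)
qed

section \<open>Spheres and balls in quotients of free commutative monoids\<close>

text \<open>Multisets over \<open>I\<close> form the free commutative monoid, and the assumption
  makes equality under \<open>\<phi>\<close> a congruence on it. The well-order on indices makes
  multisets well-ordered, which provides least representatives.\<close>

locale mset_congruence =
  fixes \<phi> :: "'i::wellorder multiset \<Rightarrow> 'b" and I :: "'i set"
  assumes finite_I: "finite I"
    and add_mset_cong: "\<lbrakk>set_mset M \<subseteq> I; set_mset N \<subseteq> I; i \<in> I; \<phi> M = \<phi> N\<rbrakk> \<Longrightarrow>
      \<phi> (add_mset i M) = \<phi> (add_mset i N)"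
begin

definition sphere :: "nat \<Rightarrow> 'b set" where
  "sphere r = \<phi> ` {M. set_mset M \<subseteq> I \<and> size M = r} - \<phi> ` {M. set_mset M \<subseteq> I \<and> size M < r}"

definition ball :: "nat \<Rightarrow> 'b set" where
  "ball r = \<phi> ` {M. set_mset M \<subseteq> I \<and> size M \<le> r}"

text \<open>The standard monomials for a degree-compatible monomial order: sizes are compared first,
  then the multiset order.\<close>

definition canonical :: "nat \<Rightarrow> 'i multiset set" where
  "canonical r = {M. set_mset M \<subseteq> I \<and> size M = r \<and>
     (\<forall>N. set_mset N \<subseteq> I \<longrightarrow> \<phi> N = \<phi> M \<longrightarrow> r < size N \<or> r = size N \<and> M \<le> N)}"

lemma bij_betw_canonical_sphere: "bij_betw \<phi> (canonical r) (sphere r)"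
proof (rule bij_betw_imageI)
  show "inj_on \<phi> (canonical r)"
  proof (rule inj_onI)
    fix M N assume "M \<in> canonical r" "N \<in> canonical r" "\<phi> M = \<phi> N"
    then have "M \<le> N" "N \<le> M" unfolding canonical_def by auto
    then show "M = N" by simp
  qed
  show "\<phi> ` canonical r = sphere r"
  proof (intro equalityI subsetI)
    fix x assume "x \<in> \<phi> ` canonical r"
    then obtain M where "M \<in> canonical r" "x = \<phi> M" by blast
    then have M: "set_mset M \<subseteq> I" "size M = r" "x = \<phi> M"
      and min: "\<And>N. set_mset N \<subseteq> I \<Longrightarrow> \<phi> N = \<phi> M \<Longrightarrow> \<not> size N < r"
      by (auto simp: canonical_def dest: less_asym)
    have "x \<in> \<phi> ` {M. set_mset M \<subseteq> I \<and> size M = r}" using M by blast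
    moreover have "x \<notin> \<phi> ` {M. set_mset M \<subseteq> I \<and> size M < r}"
      using min M(3) by auto
    ultimately show "x \<in> sphere r" unfolding sphere_def by blast
  next
    fix x assume x: "x \<in> sphere r"
    \<comment> \<open>Membership in the sphere excludes shorter representations, so a minimum among
      those of size \<open>r\<close> is a minimum among all.\<close>
    define P where "P = (\<lambda>M. set_mset M \<subseteq> I \<and> size M = r \<and> \<phi> M = x)"
    have "\<exists>M. P M" using x by (auto simp: P_def sphere_def)
    then have P: "P (LEAST M. P M)" and least: "\<And>N. P N \<Longrightarrow> (LEAST M. P M) \<le> N"
      by (auto intro: LeastI_ex Least_le)
    have "(LEAST M. P M) \<in> canonical r"
      unfolding canonical_def
    proof (intro CollectI conjI allI impI)
      fix N assume N: "set_mset N \<subseteq> I" "\<phi> N = \<phi> (LEAST M. P M)"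
      with P have "\<phi> N = x" by (simp add: P_def)
      with N have "size N < r \<Longrightarrow> x \<in> \<phi> ` {M. set_mset M \<subseteq> I \<and> size M < r}" by blast
      with x have "\<not> size N < r" by (auto simp: sphere_def)
      moreover have "size N = r \<Longrightarrow> (LEAST M. P M) \<le> N"
        using N \<open>\<phi> N = x\<close> by (intro least) (simp add: P_def)
      ultimately show "r < size N \<or> r = size N \<and> (LEAST M. P M) \<le> N" by force
    qed (use P in \<open>auto simp: P_def\<close>)
    then show "x \<in> \<phi> ` canonical r" using P by (intro rev_image_eqI) (auto simp: P_def)
  qed
qed

lemma card_canonical: "card (canonical r) = card (sphere r)"
  by (rule bij_betw_same_card[OF bij_betw_canonical_sphere])

text \<open>Adding \<open>i\<close> preserves both the congruence and the order, so a representation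
  preceding \<open>M - {#i#}\<close> would give one preceding \<open>M\<close>.\<close>

lemma canonical_remove:
  assumes "M \<in> canonical (Suc r)" "i \<in># M"
  shows "M - {#i#} \<in> canonical r"
proof -
  obtain M' where M': "M = add_mset i M'" using assms(2) by (metis insert_DiffM)
  have M: "set_mset M' \<subseteq> I" "i \<in> I" "size M' = r"
    and min: "\<And>N. set_mset N \<subseteq> I \<Longrightarrow> \<phi> N = \<phi> M \<Longrightarrow> Suc r < size N \<or> Suc r = size N \<and> M \<le> N"
    using assms(1) by (auto simp: canonical_def M')
  have "r < size N \<or> r = size N \<and> M' \<le> N" if N: "set_mset N \<subseteq> I" "\<phi> N = \<phi> M'" for N
    using min[of "add_mset i N"] add_mset_cong[OF N(1) M(1,2) N(2)] N(1) M by (auto simp: M')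
  with M show ?thesis by (simp add: canonical_def M')
qed

lemma canonical_0: "canonical 0 = {{#}}"
  by (auto simp: canonical_def)

lemma finite_canonical: "finite (canonical r)"
proof (induction r)
  case (Suc r)
  have "canonical (Suc r) \<subseteq> (\<lambda>(N, i). add_mset i N) ` (canonical r \<times> I)"
  proof
    fix M assume M: "M \<in> canonical (Suc r)"
    then have "M \<noteq> {#}" by (auto simp: canonical_def)
    then obtain i where i: "i \<in># M" by auto
    with M have "i \<in> I" by (auto simp: canonical_def)
    then show "M \<in> (\<lambda>(N, i). add_mset i N) ` (canonical r \<times> I)"
      using canonical_remove[OF M i] i by (intro image_eqI[of _ _ "(M - {#i#}, i)"]) auto
  qed
  with Suc finite_I show ?case by (meson finite_SigmaI finite_imageI finite_subset)
qed (simp add: canonical_0)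

lemma finite_sphere: "finite (sphere r)"
  using bij_betw_finite[OF bij_betw_canonical_sphere] finite_canonical by blast

text \<open>Give the pair consisting of \<open>M\<close> and its element \<open>i\<close> the weight \<open>count M i\<close>: each \<open>M\<close>
  collects its size, and each \<open>M - {#i#}\<close> receives at most \<open>r + card I\<close>.\<close>

lemma card_canonical_Suc:
  "Suc r * card (canonical (Suc r)) \<le> (r + card I) * card (canonical r)"
proof -
  let ?P = "SIGMA M:canonical (Suc r). set_mset M"
  have "Suc r * card (canonical (Suc r)) = (\<Sum>M\<in>canonical (Suc r). size M)"
    by (simp add: canonical_def)
  also have "\<dots> = (\<Sum>M\<in>canonical (Suc r). \<Sum>i\<in>set_mset M. count M i)"
    by (simp add: size_multiset_overloaded_eq)
  also have "\<dots> = (\<Sum>(M, i)\<in>?P. count M i)"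
    by (subst sum.Sigma) (auto simp: finite_canonical)
  \<comment> \<open>The weight is now a function of the pair \<open>(M - {#i#}, i)\<close>, which
    determines \<open>(M, i)\<close>; hence the sum can be reindexed.\<close>
  also have "\<dots> = (\<Sum>(M, i)\<in>?P. Suc (count (M - {#i#}) i))"
  proof (intro sum.cong refl, clarify)
    fix M i assume "i \<in># M"
    then obtain N where "M = add_mset i N" by (metis insert_DiffM)
    then show "count M i = Suc (count (M - {#i#}) i)" by simp
  qed
  also have "\<dots> = (\<Sum>(N, i)\<in>(\<lambda>(M, i). (M - {#i#}, i)) ` ?P. Suc (count N i))"
  proof -
    have "inj_on (\<lambda>(M, i). (M - {#i#}, i)) ?P"
      by (rule inj_on_inverseI[where g = "\<lambda>(N, i). (add_mset i N, i)"]) auto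
    then show ?thesis by (simp add: sum.reindex case_prod_unfold)
  qed
  also have "\<dots> \<le> (\<Sum>(N, i)\<in>canonical r \<times> I. Suc (count N i))"
  proof (rule sum_mono2)
    show "(\<lambda>(M, i). (M - {#i#}, i)) ` ?P \<subseteq> canonical r \<times> I"
    proof clarify
      fix M i assume "M \<in> canonical (Suc r)" "i \<in># M"
      moreover from this have "i \<in> I" by (auto simp: canonical_def)
      ultimately show "M - {#i#} \<in> canonical r \<and> i \<in> I"
        using canonical_remove by blast
    qed
  qed (simp_all add: finite_canonical finite_I)
  also have "\<dots> = (\<Sum>N\<in>canonical r. \<Sum>i\<in>I. Suc (count N i))"
    by (subst sum.Sigma) (auto simp: finite_canonical finite_I)
  also have "\<dots> = (\<Sum>N\<in>canonical r. r + card I)"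
  proof (rule sum.cong)
    fix N assume N: "N \<in> canonical r"
    have "(\<Sum>i\<in>I. count N i) = size N"
      unfolding size_multiset_overloaded_eq using N finite_I
      by (intro sum.mono_neutral_right) (auto simp: canonical_def not_in_iff)
    then show "(\<Sum>i\<in>I. Suc (count N i)) = r + card I"
      using N by (simp only: sum_Suc) (simp add: canonical_def)
  qed simp
  finally show ?thesis by (simp add: mult.commute)
qed

section \<open>Growth of spheres and balls\<close>

lemma card_sphere_Suc: "Suc r * card (sphere (Suc r)) \<le> (r + card I) * card (sphere r)"
  using card_canonical_Suc by (simp only: card_canonical)

lemma ball_0: "ball 0 = sphere 0"
  by (auto simp: ball_def sphere_def)

lemma ball_Suc: "ball (Suc r) = ball r \<union> sphere (Suc r)" "ball r \<inter> sphere (Suc r) = {}"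
proof -
  have "{M. set_mset M \<subseteq> I \<and> size M \<le> Suc r} =
      {M. set_mset M \<subseteq> I \<and> size M \<le> r} \<union> {M. set_mset M \<subseteq> I \<and> size M = Suc r}"
    by auto
  then show "ball (Suc r) = ball r \<union> sphere (Suc r)"
    unfolding ball_def sphere_def less_Suc_eq_le by (simp add: image_Un)
  show "ball r \<inter> sphere (Suc r) = {}"
    unfolding ball_def sphere_def less_Suc_eq_le by blast
qed

lemma ball_mono: "r \<le> k \<Longrightarrow> ball r \<subseteq> ball k"
  unfolding ball_def by (intro image_mono) auto

lemma finite_ball: "finite (ball r)"
  by (induction r) (auto simp: ball_0 ball_Suc(1) finite_sphere)

lemma card_ball_Suc: "card (ball (Suc r)) = card (ball r) + card (sphere (Suc r))"
  unfolding ball_Suc(1) by (rule card_Un_disjoint[OF finite_ball finite_sphere ball_Suc(2)])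

text \<open>By \<open>card_sphere_Suc\<close>, passing from \<open>r\<close> to \<open>Suc r\<close>
  raises \<open>r * card (sphere r)\<close> by at most \<open>card I * card (sphere r)\<close>.
  These increments telescope, and the spheres add up to the ball.\<close>

lemma card_sphere_le_ball: "Suc r * card (sphere (Suc r)) \<le> card I * card (ball r)"
proof (induction r)
  case 0
  then show ?case using card_sphere_Suc[of 0] by (simp add: ball_0)
next
  case (Suc r)
  have "Suc (Suc r) * card (sphere (Suc (Suc r))) \<le> (Suc r + card I) * card (sphere (Suc r))"
    by (rule card_sphere_Suc)
  also have "\<dots> \<le> card I * card (ball (Suc r))"
    using Suc.IH by (simp add: card_ball_Suc algebra_simps)
  finally show ?case .
qed

text \<open>For \<open>r = Suc k\<close>, adding \<open>card I * card (sphere r)\<close> to both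
  sides of \<open>card_sphere_le_ball\<close> turns the ball of radius \<open>k\<close> into the
  ball of radius \<open>r\<close>.\<close>

lemma sphere_density: "(r + card I) * card (sphere r) \<le> card I * card (ball r)"
proof (cases r)
  case (Suc k)
  then show ?thesis using card_sphere_le_ball[of k] by (simp add: card_ball_Suc algebra_simps)
qed (simp add: ball_0)

text \<open>The recursion \<open>Suc r * card (ball (Suc r)) \<le> (Suc r + card I) * card (ball
  r)\<close> holds with equality for these binomial coefficients.\<close>

lemma card_ball_le: "card (ball r) \<le> (r + card I) choose r"
proof (induction r)
  case 0
  have "card (sphere 0) = 1"
    using card_canonical[of 0] by (simp add: canonical_0)
  then show ?case by (simp add: ball_0)
next
  case (Suc r)
  have "Suc r * card (ball (Suc r)) = Suc r * card (ball r) + Suc r * card (sphere (Suc r))"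
    by (simp only: card_ball_Suc distrib_left)
  also have "\<dots> \<le> Suc r * card (ball r) + card I * card (ball r)"
    by (intro add_left_mono card_sphere_le_ball)
  also have "\<dots> = Suc (r + card I) * card (ball r)"
    by (simp add: algebra_simps)
  also have "\<dots> \<le> Suc (r + card I) * ((r + card I) choose r)"
    using Suc.IH by (intro mult_left_mono) auto
  also have "\<dots> = Suc r * ((Suc r + card I) choose Suc r)"
    using Suc_times_binomial[of r "r + card I"] by simp
  finally show ?case using Suc_mult_le_cancel1 by blast
qed

text \<open>A shortest representation never contains both an element and its inverse, so it uses at
  most half of \<open>I\<close>.\<close>

lemma card_ball_le_inverses:
  assumes inv: "\<And>i. i \<in> I \<Longrightarrow> j i \<in> I \<and> j i \<noteq> i"
    and inj: "inj_on j I"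
    and cancel: "\<And>i M. i \<in> I \<Longrightarrow> set_mset M \<subseteq> I \<Longrightarrow> \<phi> (add_mset i (add_mset (j i) M)) = \<phi> M"
  shows "card (ball r) \<le> 2 ^ card I * ((r + card I div 2) choose r)"
proof -
  \<comment> \<open>The possible supports of shortest representations; there are at most
    \<open>2 ^ card I\<close> of them.\<close>
  define \<U> where "\<U> = {U. U \<subseteq> I \<and> card U \<le> card I div 2}"
  have "ball r \<subseteq> (\<Union>U\<in>\<U>. mset_congruence.ball \<phi> U r)"
  proof
    fix x assume "x \<in> ball r"
    then obtain M0 where M0: "set_mset M0 \<subseteq> I" "size M0 \<le> r" "\<phi> M0 = x" by (auto simp: ball_def)
    then obtain M where M: "set_mset M \<subseteq> I" "\<phi> M = x"
      and min: "\<And>N. set_mset N \<subseteq> I \<Longrightarrow> \<phi> N = x \<Longrightarrow> size M \<le> size N"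
      using ex_has_least_nat[of "\<lambda>M. set_mset M \<subseteq> I \<and> \<phi> M = x" M0 size] by auto
    have "j i \<notin># M" if i: "i \<in># M" for i
    proof
      assume "j i \<in># M"
      have "i \<in> I" using i M by auto
      with \<open>j i \<in># M\<close> i inv obtain N where N: "M = add_mset i (add_mset (j i) N)"
        by (metis insert_DiffM insert_noteq_member)
      with cancel[of i N] M \<open>i \<in> I\<close> min[of N] show False by auto
    qed
    then have disj: "set_mset M \<inter> j ` set_mset M = {}" by auto
    have "2 * card (set_mset M) = card (set_mset M \<union> j ` set_mset M)"
      using disj inj_on_subset[OF inj M(1)] by (simp add: card_Un_disjoint card_image)
    also have "\<dots> \<le> card I"
      using M inv by (intro card_mono finite_I) auto
    finally have "set_mset M \<in> \<U>" using M by (simp add: \<U>_def)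
    \<comment> \<open>Over the support alone \<open>\<phi>\<close> is again a congruence, so
      \<open>card_ball_le\<close> applies with the support in place of \<open>I\<close>.\<close>
    moreover have "mset_congruence \<phi> (set_mset M)"
      using M finite_I add_mset_cong by unfold_locales (auto simp: subset_iff)
    then have "x \<in> mset_congruence.ball \<phi> (set_mset M) r"
      using M min[of M0] M0 by (auto simp: mset_congruence.ball_def)
    ultimately show "x \<in> (\<Union>U\<in>\<U>. mset_congruence.ball \<phi> U r)" by blast
  qed
  moreover have U: "finite (mset_congruence.ball \<phi> U r)"
    "card (mset_congruence.ball \<phi> U r) \<le> (r + card I div 2) choose r" if "U \<in> \<U>" for U
  proof -
    interpret U: mset_congruence \<phi> U
      using that finite_I add_mset_cong
      by unfold_locales (auto simp: \<U>_def subset_iff intro: finite_subset)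
    show "finite (U.ball r)" by (rule U.finite_ball)
    have "card (U.ball r) \<le> (r + card U) choose r" by (rule U.card_ball_le)
    also have "(r + card U) choose r \<le> (r + card I div 2) choose r"
      using that by (intro binomial_right_mono) (auto simp: \<U>_def)
    finally show "card (U.ball r) \<le> (r + card I div 2) choose r" .
  qed
  moreover have fin: "finite \<U>" "card \<U> \<le> 2 ^ card I"
    using finite_I card_mono[of "Pow I" \<U>] by (auto simp: \<U>_def card_Pow)
  ultimately have "card (ball r) \<le> card (\<Union>U\<in>\<U>. mset_congruence.ball \<phi> U r)"
    by (intro card_mono) auto
  also have "\<dots> \<le> (\<Sum>U\<in>\<U>. card (mset_congruence.ball \<phi> U r))"
    using fin by (intro card_UN_le)
  also have "\<dots> \<le> (\<Sum>U\<in>\<U>. (r + card I div 2) choose r)"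
    using U by (intro sum_mono)
  also have "\<dots> \<le> 2 ^ card I * ((r + card I div 2) choose r)"
    using fin by simp
  finally show ?thesis .
qed

end

section \<open>Estimates\<close>

lemma power_div_fact_le_exp:
  fixes x :: real
  assumes "x \<ge> 0"
  shows "x ^ k / fact k \<le> exp x"
proof -
  have "(\<Sum>n\<in>{k}. x ^ n /\<^sub>R fact n) \<le> (\<Sum>n. x ^ n /\<^sub>R fact n)"
    using assms by (intro sum_le_suminf summable_exp_generic) auto
  then show ?thesis by (simp add: exp_def divide_inverse mult.commute)
qed

text \<open>Combines \<open>(r + p choose p) * fact p \<le> (r + p) ^ p\<close> with
  \<open>p ^ p \<le> exp 1 ^ p * fact p\<close>, a single term of the exponential series.\<close>

lemma binomial_le_exp_power:
  assumes "p \<ge> 1"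
  shows "real ((r + p) choose r) \<le> (exp 1 * (real (r + p) / real p)) ^ p"
proof -
  have "real ((r + p) choose p) * fact p \<le> real (r + p) ^ p"
  proof -
    have "real (((r + p) choose p) * fact p) \<le> real ((r + p) ^ p)"
      using binomial_fact_pow[of "r + p" p] by (simp only: of_nat_le_iff)
    then show ?thesis by (simp only: of_nat_mult of_nat_fact of_nat_power)
  qed
  moreover have "real p ^ p \<le> exp 1 ^ p * fact p"
  proof -
    have "real p ^ p / fact p \<le> exp 1 ^ p"
      using power_div_fact_le_exp[of "real p" p] exp_of_nat_mult[of p "1::real"] by simp
    then show ?thesis by (simp add: pos_divide_le_eq)
  qed
  ultimately have "real ((r + p) choose p) * fact p * real p ^ p
      \<le> real (r + p) ^ p * (exp 1 ^ p * fact p)"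
    by (intro mult_mono) (simp_all del: of_nat_add)
  then have "fact p * (real ((r + p) choose p) * real p ^ p) \<le> fact p * (exp 1 * real (r + p)) ^ p"
    by (simp only: power_mult_distrib mult_ac)
  then have "real ((r + p) choose p) * real p ^ p \<le> (exp 1 * real (r + p)) ^ p"
    by (rule mult_left_le_imp_le) simp
  moreover have "(r + p) choose r = (r + p) choose p"
    using binomial_symmetric[of r "r + p"] by simp
  ultimately show ?thesis
    using assms by (simp only: times_divide_eq_right power_divide) (simp add: pos_le_divide_eq del: of_nat_add)
qed

text \<open>With \<open>q = (r + d) / d\<close>, density gives \<open>a \<le> b / q\<close>, while
  \<open>b\<close> is at most both \<open>n\<close> and \<open>(c * q) ^ p\<close>. The first bound
  on \<open>b\<close> suffices if the root \<open>m\<close> of \<open>n\<close> is at most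
  \<open>c * q\<close>, the second otherwise. In \<open>c = 24 * exp 1\<close> the 8 comes from the
  bound on \<open>b\<close>, the 3 from \<open>d \<le> 3 * p\<close>, and \<open>exp 1\<close> from
  the binomial estimate.\<close>

lemma sphere_bound:
  fixes a b n :: real
  assumes dens: "(real r + real d) * a \<le> real d * b" and "0 \<le> a" "b \<le> n"
    and ball: "b \<le> 8 ^ p * real ((r + p) choose r)"
    and p: "1 \<le> p" "p \<le> d" "d \<le> 3 * p" and "0 < n"
  shows "a * n powr (1 / real p) \<le> 24 * exp 1 * n"
proof -
  define c :: real where "c = 24 * exp 1"
  define q where "q = (real r + real d) / real d"
  define m where "m = n powr (1 / real p)"
  have c: "c > 0" and q: "q > 0" using p by (auto simp: c_def q_def add_nonneg_pos)
  have m: "m > 0" "m ^ p = n"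
    using p \<open>0 < n\<close> by (simp_all add: m_def powr_powr flip: powr_realpow)
  have aq: "a \<le> b / q"
    using dens p by (simp add: q_def pos_le_divide_eq pos_divide_le_eq mult.commute)
  have "real (r + p) / real p \<le> 3 * q"
  proof -
    have "real r / real p \<le> real r / (real d / 3)"
      using p by (intro divide_left_mono) auto
    then show ?thesis using p by (simp add: q_def add_divide_distrib mult.commute)
  qed
  then have "exp 1 * (real (r + p) / real p) \<le> exp 1 * (3 * q)"
    by (intro mult_left_mono) auto
  then have "(exp 1 * (real (r + p) / real p)) ^ p \<le> (exp 1 * (3 * q)) ^ p"
    by (intro power_mono) auto
  then have "real ((r + p) choose r) \<le> (exp 1 * (3 * q)) ^ p"
    using binomial_le_exp_power[OF p(1), of r] by (rule order_trans[rotated])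
  then have "8 ^ p * real ((r + p) choose r) \<le> 8 ^ p * (exp 1 * (3 * q)) ^ p"
    by (rule mult_left_mono) simp
  also have "\<dots> = (8 * (exp 1 * (3 * q))) ^ p" by (simp only: power_mult_distrib)
  also have "8 * (exp 1 * (3 * q)) = c * q" by (simp add: c_def)
  finally have b: "b \<le> (c * q) ^ p" using ball by (rule order_trans[rotated])
  have "a * m \<le> c * n"
  proof (cases "m \<le> c * q")
    case True
    have "a * m \<le> b / q * m" using aq m by (intro mult_right_mono) auto
    also have "\<dots> \<le> n / q * m" using assms q m by (intro mult_right_mono divide_right_mono) auto
    also have "\<dots> \<le> n / q * (c * q)" using True assms q by (intro mult_left_mono) auto
    also have "\<dots> = c * n" using q by simp
    finally show ?thesis .
  next
    case False
    obtain k where k: "p = Suc k" using p by (cases p) auto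
    have "a * m \<le> b / q * m" using aq m by (intro mult_right_mono) auto
    also have "\<dots> \<le> (c * q) ^ p / q * m" using b q m by (intro mult_right_mono divide_right_mono) auto
    also have "\<dots> = c * (c * q) ^ k * m" using q by (simp add: k)
    also have "\<dots> \<le> c * m ^ k * m"
      using False c q m by (intro mult_right_mono mult_left_mono power_mono) auto
    also have "\<dots> = c * n" using m(2) by (simp add: k mult_ac)
    finally show ?thesis .
  qed
  then show ?thesis by (simp add: c_def m_def)
qed

lemma ln_powr_le_powr_inverse:
  fixes x y :: real
  assumes "1 < x" "0 < y" "0 < p" "p * (\<kappa> * ln (ln x)) \<le> ln y"
  shows "ln x powr \<kappa> \<le> y powr (1 / p)"
proof -
  have "\<kappa> * ln (ln x) \<le> ln y / p" using assms by (simp add: field_simps)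
  then show ?thesis using assms by (simp add: powr_def)
qed

lemma eventually_ln_ln_ge: "\<exists>n0::nat. \<forall>n\<ge>n0. 1 < ln (real n) \<and> c < ln (ln (real n))"
proof -
  have "filterlim (\<lambda>n::nat. ln (ln (real n))) at_top sequentially"
    "filterlim (\<lambda>n::nat. ln (real n)) at_top sequentially"
    by (intro filterlim_compose[OF ln_at_top] filterlim_real_sequentially)+
  then have "\<forall>\<^sub>F n::nat in sequentially. 1 < ln (real n) \<and> c < ln (ln (real n))"
    unfolding filterlim_at_top_dense by (intro eventually_conj) auto
  then show ?thesis unfolding eventually_sequentially .
qed

section \<open>Layers of a Cayley digraph\<close>

text \<open>Only generators in \<open>S\<^sub>0\<close> count as steps between cosets; the others
  lie in \<open>H\<close> and fix every coset. The enumeration \<open>e\<close> supplies the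
  well-ordered index type, as the group elements carry no order.\<close>

locale cayley_layers = comm_group G for G :: "'a monoid" (structure) +
  fixes S S\<^sub>0 H :: "'a set" and e :: "nat \<Rightarrow> 'a"
  assumes finite_carrier: "finite (carrier G)"
    and S_sub: "S \<subseteq> carrier G"
    and con: "strongly_connected (with_proj (Cay G S))"
    and subgroup_H: "subgroup H G"
    and S0_sub: "S\<^sub>0 \<subseteq> S" and S_diff_sub: "S - S\<^sub>0 \<subseteq> H"
    and bij_e: "bij_betw e {..<card S\<^sub>0} S\<^sub>0"
begin

definition word :: "nat multiset \<Rightarrow> 'a" where
  "word M = finprod G (\<lambda>i. e i [^] count M i) {..<card S\<^sub>0}"

definition word_coset :: "nat multiset \<Rightarrow> 'a set" where
  "word_coset M = H #> word M"

lemma e_mem: "i < card S\<^sub>0 \<Longrightarrow> e i \<in> S\<^sub>0"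
  using bij_e by (auto simp: bij_betw_def)

lemma e_closed: "i < card S\<^sub>0 \<Longrightarrow> e i \<in> carrier G"
  using e_mem S0_sub S_sub by blast

lemma H_sub: "H \<subseteq> carrier G"
  by (rule subgroup.subset[OF subgroup_H])

lemma word_closed: "word M \<in> carrier G"
  unfolding word_def using e_closed by (intro finprod_closed) auto

lemma word_empty: "word {#} = \<one>"
  unfolding word_def by (rule finprod_one_eqI) simp

lemma word_add_mset:
  assumes "i < card S\<^sub>0"
  shows "word (add_mset i M) = word M \<otimes> e i"
proof -
  let ?I = "{..<card S\<^sub>0}"
  have "word (add_mset i M) = finprod G (\<lambda>k. e k [^] count M k \<otimes> (if i = k then e k else \<one>)) ?I"
    unfolding word_def using e_closed by (intro finprod_cong') auto
  also have "\<dots> = word M \<otimes> finprod G (\<lambda>k. if i = k then e k else \<one>) ?I"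
    unfolding word_def using e_closed by (intro finprod_multf) auto
  also have "finprod G (\<lambda>k. if i = k then e k else \<one>) ?I = e i"
    using finprod_singleton[of i ?I e] assms e_closed by auto
  finally show ?thesis .
qed

lemma word_coset_add_mset:
  "i < card S\<^sub>0 \<Longrightarrow> word_coset (add_mset i M) = word_coset M #> e i"
  by (simp add: word_coset_def word_add_mset coset_mult_assoc H_sub word_closed e_closed)

sublocale Q: mset_congruence word_coset "{..<card S\<^sub>0}"
  by unfold_locales (auto simp: word_coset_add_mset)

text \<open>A generator in \<open>S\<^sub>0\<close> appends one letter to a representing word; one
  in \<open>H\<close> is absorbed by the coset, because it commutes with \<open>x\<close>.\<close>

lemma ball_step:
  assumes "x \<in> carrier G" "s \<in> S" "H #> x \<in> Q.ball k"
  shows "H #> (x \<otimes> s) \<in> Q.ball (Suc k)"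
proof -
  obtain M where M: "set_mset M \<subseteq> {..<card S\<^sub>0}" "size M \<le> k" "word_coset M = H #> x"
    using assms(3) by (auto simp: Q.ball_def)
  have s: "s \<in> carrier G" using assms S_sub by blast
  show ?thesis
  proof (cases "s \<in> S\<^sub>0")
    case True
    then have "s \<in> e ` {..<card S\<^sub>0}" by (simp only: bij_betw_imp_surj_on[OF bij_e])
    then obtain i where i: "i < card S\<^sub>0" "e i = s" by blast
    have "H #> (x \<otimes> s) = word_coset (add_mset i M)"
      by (simp only: word_coset_add_mset[OF i(1)] M(3) i(2) coset_mult_assoc[OF H_sub assms(1) s])
    then show ?thesis
      unfolding Q.ball_def using M(1,2) i(1) by (intro image_eqI[of _ _ "add_mset i M"]) auto
  next
    case False
    then have "s \<in> H" using assms S_diff_sub by blast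
    have "H #> (x \<otimes> s) = (H #> s) #> x"
      by (simp only: m_comm[OF assms(1) s] coset_mult_assoc[OF H_sub s assms(1)])
    also have "\<dots> = word_coset M"
      by (simp only: coset_join2[OF s subgroup_H \<open>s \<in> H\<close>] M(3))
    finally show ?thesis
      unfolding Q.ball_def using M(1,2) by (intro image_eqI[of _ _ M]) auto
  qed
qed

text \<open>Follows a directed path from the identity to \<open>x\<close>; this makes
  \<open>depth\<close> meaningful on the whole group.\<close>

lemma ex_ball:
  assumes "x \<in> carrier G"
  shows "\<exists>k. H #> x \<in> Q.ball k"
proof -
  have "(\<one>, x) \<in> rtrancl_on (carrier G) (parcs (Cay G S))"
    using con assms by (auto simp: strongly_connected_def reachable_def Cay_def)
  then show ?thesis
  proof (induction rule: rtrancl_on_induct)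
    case base
    have "H #> \<one> = word_coset {#}" by (simp add: word_coset_def word_empty)
    then have "H #> \<one> \<in> Q.ball 0"
      unfolding Q.ball_def by (intro image_eqI[of _ _ "{#}"]) auto
    then show ?case ..
  next
    case (step y z)
    then obtain s k where "y \<in> carrier G" "s \<in> S" "z = y \<otimes> s" "H #> y \<in> Q.ball k"
      by (auto simp: Cay_def)
    then show ?case using ball_step by blast
  qed
qed

definition depth :: "'a \<Rightarrow> nat" where
  "depth x = (LEAST k. H #> x \<in> Q.ball k)"

lemma depth_ball: "x \<in> carrier G \<Longrightarrow> H #> x \<in> Q.ball (depth x)"
  unfolding depth_def by (rule LeastI_ex[OF ex_ball])

lemma depth_step:
  "x \<in> carrier G \<Longrightarrow> s \<in> S \<Longrightarrow> depth (x \<otimes> s) \<le> Suc (depth x)"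
  unfolding depth_def[of "x \<otimes> s"] by (intro Least_le ball_step depth_ball)

lemma depth_sphere:
  assumes "x \<in> carrier G"
  shows "H #> x \<in> Q.sphere (depth x)"
proof (cases "depth x")
  case 0
  then show ?thesis using depth_ball[OF assms] by (simp add: Q.ball_0)
next
  case (Suc k)
  then have "H #> x \<notin> Q.ball k"
    using not_less_Least[of k "\<lambda>k. H #> x \<in> Q.ball k"] by (simp add: depth_def)
  then show ?thesis using depth_ball[OF assms] Suc by (auto simp: Q.ball_Suc)
qed

lemma word_coset_rcosets: "word_coset M \<in> rcosets H"
  unfolding word_coset_def using H_sub word_closed by (rule rcosetsI)

lemma card_depth_layer:
  "card {x \<in> carrier G. depth x = r} \<le> card H * card (Q.sphere r)"
proof -
  have sub: "Q.sphere r \<subseteq> rcosets H"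
    using word_coset_rcosets by (auto simp: Q.sphere_def)
  have card_c: "card c = card H" if "c \<in> Q.sphere r" for c
    using card_rcosets_equal[of c H] that sub H_sub by auto
  have "{x \<in> carrier G. depth x = r} \<subseteq> \<Union> (Q.sphere r)"
    using depth_sphere rcos_self[OF _ subgroup_H] by blast
  moreover have "\<Union> (Q.sphere r) \<subseteq> carrier G"
    using sub rcosets_part_G[OF subgroup_H] by blast
  ultimately have "card {x \<in> carrier G. depth x = r} \<le> card (\<Union> (Q.sphere r))"
    using finite_carrier by (meson card_mono finite_subset)
  also have "\<dots> \<le> (\<Sum>c\<in>Q.sphere r. card c)" by (rule card_Union_le_sum_card)
  also have "\<dots> = card H * card (Q.sphere r)" using card_c by simp
  finally show ?thesis .
qed

lemma finite_rcosets: "finite (rcosets H)"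
  using finite_carrier by (simp add: RCOSETS_def)

lemma card_ball_le_index: "card (Q.ball r) \<le> card (rcosets H)"
  using word_coset_rcosets by (intro card_mono finite_rcosets) (auto simp: Q.ball_def)

text \<open>Lets an upper bound on balls bound the index, which later excludes
  \<open>p = 0\<close>.\<close>

lemma ex_ball_eq_rcosets: "\<exists>r. Q.ball r = rcosets H"
proof -
  define r where "r = Max (depth ` carrier G)"
  have "H #> x \<in> Q.ball r" if x: "x \<in> carrier G" for x
  proof -
    have "depth x \<le> r" unfolding r_def using x finite_carrier by (intro Max_ge) auto
    then show ?thesis using depth_ball[OF x] Q.ball_mono by blast
  qed
  then have "rcosets H \<subseteq> Q.ball r" by (auto simp: RCOSETS_def)
  moreover have "Q.ball r \<subseteq> rcosets H" using word_coset_rcosets by (auto simp: Q.ball_def)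
  ultimately show ?thesis by blast
qed

lemma cop_number_bound:
  assumes p: "1 \<le> p" "p \<le> card S\<^sub>0" "card S\<^sub>0 \<le> 3 * p"
    and ball: "\<And>r. card (Q.ball r) \<le> 8 ^ p * ((r + p) choose r)"
  shows "real (cop_number (with_proj (Cay G S)) s)
    \<le> 48 * exp 1 * (real (order G) / real (card (rcosets H)) powr (1 / real p))"
proof -
  define m where "m = real (card (rcosets H)) powr (1 / real p)"
  \<comment> \<open>Size of one team. Two teams are needed, which doubles 24 to 48.\<close>
  define K where "K = nat \<lfloor>24 * exp 1 * (real (order G) / m)\<rfloor>"
  have ord: "card (rcosets H) * card H = order G" by (rule lagrange[OF subgroup_H])
  have "order G > 0" using finite_carrier by (simp add: order_gt_0_iff_finite)
  with ord have idx: "card (rcosets H) > 0" by (metis gr0I mult_is_0)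
  then have m: "m > 0" by (simp add: m_def)
  have layer: "card {x \<in> carrier G. depth x = r} \<le> K" for r
  proof -
    have "real (card (Q.sphere r)) * m \<le> 24 * exp 1 * real (card (rcosets H))"
      unfolding m_def
    proof (rule sphere_bound[where b = "real (card (Q.ball r))"])
      show "(real r + real (card S\<^sub>0)) * real (card (Q.sphere r))
          \<le> real (card S\<^sub>0) * real (card (Q.ball r))"
        using Q.sphere_density[of r] by (simp flip: of_nat_add of_nat_mult)
      show "real (card (Q.ball r)) \<le> 8 ^ p * real ((r + p) choose r)"
        using ball[of r] by (metis of_nat_le_iff of_nat_mult of_nat_numeral of_nat_power)
    qed (use p idx card_ball_le_index in auto)
    \<comment> \<open>Passes from cosets to vertices: each coset has \<open>card H\<close> elements,
      and the index times \<open>card H\<close> is the order of the group.\<close>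
    then have "real (card H) * (real (card (Q.sphere r)) * m)
        \<le> real (card H) * (24 * exp 1 * real (card (rcosets H)))"
      by (intro mult_left_mono) auto
    also have "\<dots> = 24 * exp 1 * real (order G)"
      by (simp flip: ord)
    finally have "real (card H * card (Q.sphere r)) \<le> 24 * exp 1 * (real (order G) / m)"
      using m by (simp add: pos_le_divide_eq mult_ac)
    then have "card H * card (Q.sphere r) \<le> K"
      unfolding K_def by (rule le_nat_floor)
    then show ?thesis using card_depth_layer[of r] by (rule order_trans[rotated])
  qed
  have "cops_win (with_proj (Cay G S)) s (2 * K)"
  proof (rule cops_win_levels[where f = depth])
    show "depth v \<le> Suc (depth u)" if "(u, v) \<in> arcs_ends (with_proj (Cay G S))" for u v
      using that depth_step by (auto simp: Cay_def)
  qed (use con finite_carrier layer in \<open>simp_all add: Cay_def\<close>)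
  then have "cop_number (with_proj (Cay G S)) s \<le> 2 * K"
    unfolding cop_number_def by (rule Least_le)
  then have "real (cop_number (with_proj (Cay G S)) s) \<le> 2 * real K" by linarith
  also have "real K \<le> 24 * exp 1 * (real (order G) / m)"
    unfolding K_def using m by (intro of_nat_floor) auto
  finally show ?thesis by (simp add: m_def)
qed

end

text \<open>Adjoining \<open>g\<close> multiplies \<open>H\<close> by the subgroup
  \<open>{\<one>, g}\<close>, which at most doubles its size.\<close>

lemma (in comm_group) ex_subgroup_of_involutions:
  assumes "finite T" "T \<subseteq> carrier G" "\<And>x. x \<in> T \<Longrightarrow> x \<otimes> x = \<one>"
  shows "\<exists>H. subgroup H G \<and> T \<subseteq> H \<and> finite H \<and> card H \<le> 2 ^ card T"
  using assms
proof (induction T)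
  case empty
  then show ?case by (intro exI[of _ "{\<one>}"]) (simp add: triv_subgroup)
next
  case (insert g T)
  then obtain H where H: "subgroup H G" "T \<subseteq> H" "finite H" "card H \<le> 2 ^ card T" by auto
  have g: "g \<in> carrier G" "g \<otimes> g = \<one>" using insert.prems by auto
  then have "inv g = g" by (metis inv_equality)
  with g have K: "subgroup {\<one>, g} G" by unfold_locales auto
  have eq: "H <#> {\<one>, g} = (\<lambda>(h, k). h \<otimes> k) ` (H \<times> {\<one>, g})"
    by (auto simp: set_mult_def)
  have "card (H <#> {\<one>, g}) \<le> card (H \<times> {\<one>, g})"
    unfolding eq using H(3) by (intro card_image_le) auto
  also have "\<dots> \<le> card H * 2" using H(3) by (simp add: card_cartesian_product card_insert_if)
  also have "\<dots> \<le> 2 ^ card (insert g T)" using H(4) insert.hyps by simp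
  finally have "card (H <#> {\<one>, g}) \<le> 2 ^ card (insert g T)" .
  moreover have "insert g T \<subseteq> H <#> {\<one>, g}"
  proof
    fix x assume "x \<in> insert g T"
    then have "\<exists>h\<in>H. \<exists>k\<in>{\<one>, g}. h \<otimes> k = x"
      using H(2) g(1) subgroup.one_closed[OF H(1)] subgroup.mem_carrier[OF H(1)]
      by (elim insertE) (blast intro: l_one r_one)+
    then show "x \<in> H <#> {\<one>, g}" by (auto simp: set_mult_def)
  qed
  ultimately show ?case
    using mult_subgroups[OF H(1) K] H(3) by (intro exI[of _ "H <#> {\<one>, g}"]) (simp add: eq)
qed

section \<open>The two bounds\<close>

lemma cayley_layersI:
  assumes "abelian_cayley_datum G S" "strongly_connected (with_proj (Cay G S))"
    and "subgroup H G" "S\<^sub>0 \<subseteq> S" "S - S\<^sub>0 \<subseteq> H"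
  obtains e where "cayley_layers G S S\<^sub>0 H e"
proof -
  have G: "comm_group G" "finite (carrier G)" "S \<subseteq> carrier G"
    using assms(1) by (auto simp: abelian_cayley_datum_def)
  then have "finite S\<^sub>0" using assms(4) by (meson finite_subset)
  then obtain e where "bij_betw e {..<card S\<^sub>0} S\<^sub>0"
    using ex_bij_betw_nat_finite by (metis atLeast0LessThan)
  with G assms have "cayley_layers G S S\<^sub>0 H e"
    by (intro cayley_layers.intro cayley_layers_axioms.intro)
  then show ?thesis by (rule that)
qed

lemma cop_number_cayley_le:
  assumes datum: "abelian_cayley_datum G S" and con: "strongly_connected (with_proj (Cay G S))"
    and n: "1 < ln (real (order G))"
    and deg: "real (card S) * (\<kappa> * ln (ln (real (order G)))) \<le> ln (real (order G))"
  shows "real (cop_number (with_proj (Cay G S)) s)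
    \<le> 48 * exp 1 * (real (order G) / ln (real (order G)) powr \<kappa>)"
proof -
  interpret comm_group G using datum by (simp add: abelian_cayley_datum_def)
  obtain e where "cayley_layers G S S {\<one>\<^bsub>G\<^esub>} e"
    using cayley_layersI[OF datum con triv_subgroup] by blast
  then interpret cayley_layers G S S "{\<one>\<^bsub>G\<^esub>}" e .
  have idx: "card (rcosets\<^bsub>G\<^esub> {\<one>\<^bsub>G\<^esub>}) = order G"
    using lagrange[OF subgroup_H] by simp
  have ball: "card (Q.ball r) \<le> (r + card S) choose r" for r
    using Q.card_ball_le[of r] by simp
  \<comment> \<open>Without generators every ball would have at most one element, whereas the group
    has at least two.\<close>
  obtain r where "Q.ball r = rcosets\<^bsub>G\<^esub> {\<one>\<^bsub>G\<^esub>}" using ex_ball_eq_rcosets by blast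
  with ball[of r] idx have "order G \<le> (r + card S) choose r" by simp
  moreover have "2 \<le> order G" using datum by (simp add: abelian_cayley_datum_def)
  ultimately have p: "1 \<le> card S" by (cases "card S") auto
  have "card (Q.ball r) \<le> 8 ^ card S * ((r + card S) choose r)" for r
    using mult_le_mono[OF one_le_power[of "8::nat" "card S"] ball[of r]] by simp
  then have "real (cop_number (with_proj (Cay G S)) s)
      \<le> 48 * exp 1 * (real (order G) / real (order G) powr (1 / real (card S)))"
    using cop_number_bound[of "card S" s] p idx by simp
  also have "\<dots> \<le> 48 * exp 1 * (real (order G) / ln (real (order G)) powr \<kappa>)"
  proof (intro mult_left_mono divide_left_mono)
    show "ln (real (order G)) powr \<kappa> \<le> real (order G) powr (1 / real (card S))"
      using n deg p \<open>2 \<le> order G\<close> by (intro ln_powr_le_powr_inverse) auto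
    show "0 < real (order G) powr (1 / real (card S)) * ln (real (order G)) powr \<kappa>"
      using n \<open>2 \<le> order G\<close> by simp
  qed auto
  finally show ?thesis .
qed

lemma cop_number_symmetric_cayley_le:
  assumes datum: "abelian_cayley_datum G S" and con: "strongly_connected (with_proj (Cay G S))"
    and sym: "S = m_inv G ` S"
    and n: "1 < ln (real (order G))" and \<kappa>: "ln 2 < \<kappa> * ln (ln (real (order G)))"
    and deg: "real (card S) * (\<kappa> * ln (ln (real (order G)))) \<le> ln (real (order G))"
  shows "real (cop_number (with_proj (Cay G S)) s)
    \<le> 48 * exp 1 * (real (order G) / ln (real (order G)) powr (2 * \<kappa>))"
proof -
  interpret comm_group G using datum by (simp add: abelian_cayley_datum_def)
  have S: "S \<subseteq> carrier G" and fin: "finite S" and ord: "2 \<le> order G"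
    using datum by (auto simp: abelian_cayley_datum_def intro: finite_subset)
  \<comment> \<open>The involutions are moved into \<open>H\<close>. This divides the number of
    cosets by at most \<open>2 ^ card T\<close>, but removes \<open>card T\<close> generators from
    the count.\<close>
  define T where "T = {x \<in> S. x \<otimes>\<^bsub>G\<^esub> x = \<one>\<^bsub>G\<^esub>}"
  define S\<^sub>0 where "S\<^sub>0 = S - T"
  obtain H where H: "subgroup H G" "T \<subseteq> H" "card H \<le> 2 ^ card T"
  proof -
    have "finite T" "T \<subseteq> carrier G" "\<And>x. x \<in> T \<Longrightarrow> x \<otimes>\<^bsub>G\<^esub> x = \<one>\<^bsub>G\<^esub>"
      using S fin by (auto simp: T_def)
    from ex_subgroup_of_involutions[OF this] that show ?thesis by blast
  qed
  have card_S: "card S = card T + card S\<^sub>0"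
  proof -
    have "T \<subseteq> S" by (auto simp: T_def)
    then show ?thesis
      using card_Diff_subset[OF finite_subset[OF _ fin]] card_mono[OF fin] by (simp add: S\<^sub>0_def)
  qed
  obtain e where "cayley_layers G S S\<^sub>0 H e"
  proof -
    have "S\<^sub>0 \<subseteq> S" "S - S\<^sub>0 \<subseteq> H" using H(2) unfolding S\<^sub>0_def by blast+
    from cayley_layersI[OF datum con H(1) this] that show ?thesis by blast
  qed
  then interpret cayley_layers G S S\<^sub>0 H e .
  define N where "N = card (rcosets\<^bsub>G\<^esub> H)"
  define p where "p = card S\<^sub>0 div 2"
  define L where "L = \<kappa> * ln (ln (real (order G)))"
  have NH: "N * card H = order G"
    unfolding N_def by (rule lagrange[OF subgroup_H])
  have N: "N > 0" using NH ord by (cases N) auto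
  have "order G \<le> N * 2 ^ card T"
    unfolding NH[symmetric] using H(3) by simp
  then have "real (order G) \<le> real N * 2 ^ card T"
    by (metis of_nat_le_iff of_nat_mult of_nat_numeral of_nat_power)
  then have "ln (real (order G)) \<le> ln (real N * 2 ^ card T)"
    using ord by (subst ln_le_cancel_iff) (use N in auto)
  also have "\<dots> = ln (real N) + real (card T) * ln 2"
    using N by (simp add: ln_mult ln_realpow)
  finally have lnN: "ln (real (order G)) \<le> ln (real N) + real (card T) * ln 2" .

  have inv_S0: "inv\<^bsub>G\<^esub> x \<in> S\<^sub>0 \<and> inv\<^bsub>G\<^esub> x \<noteq> x" if x: "x \<in> S\<^sub>0" for x
  proof -
    have xG: "x \<in> carrier G" "x \<in> S" "x \<otimes>\<^bsub>G\<^esub> x \<noteq> \<one>\<^bsub>G\<^esub>"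
      using x S by (auto simp: S\<^sub>0_def T_def)
    have ne: "inv\<^bsub>G\<^esub> x \<noteq> x" using r_inv[OF xG(1)] xG(3) by metis
    have "inv\<^bsub>G\<^esub> x \<otimes>\<^bsub>G\<^esub> inv\<^bsub>G\<^esub> x \<noteq> \<one>\<^bsub>G\<^esub>"
      using inv_equality[of "inv\<^bsub>G\<^esub> x" "inv\<^bsub>G\<^esub> x"] xG(1) ne by auto
    moreover have "inv\<^bsub>G\<^esub> x \<in> S" using xG(2) sym by blast
    ultimately show ?thesis using ne by (simp add: S\<^sub>0_def T_def)
  qed
  \<comment> \<open>Inversion on \<open>S\<^sub>0\<close>, transported to indices; it has no fixed
    point there since the involutions are gone.\<close>
  define j where "j = (\<lambda>i. inv_into {..<card S\<^sub>0} e (inv\<^bsub>G\<^esub> (e i)))"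
  have e_inj: "inj_on e {..<card S\<^sub>0}" and e_img: "e ` {..<card S\<^sub>0} = S\<^sub>0"
    using bij_e unfolding bij_betw_def by blast+
  have j: "j i < card S\<^sub>0" "e (j i) = inv\<^bsub>G\<^esub> (e i)" if i: "i < card S\<^sub>0" for i
  proof -
    have im: "inv\<^bsub>G\<^esub> (e i) \<in> e ` {..<card S\<^sub>0}"
      unfolding e_img using inv_S0 e_mem[OF i] by blast
    show "j i < card S\<^sub>0" using inv_into_into[OF im] by (simp add: j_def)
    show "e (j i) = inv\<^bsub>G\<^esub> (e i)" unfolding j_def by (rule f_inv_into_f[OF im])
  qed
  have "card (Q.ball r) \<le> 2 ^ card {..<card S\<^sub>0} * ((r + card {..<card S\<^sub>0} div 2) choose r)" for r
  proof (rule Q.card_ball_le_inverses[where j = j])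
    fix i assume "i \<in> {..<card S\<^sub>0}"
    then have i: "i < card S\<^sub>0" by simp
    then have "e (j i) \<noteq> e i" using j(2)[OF i] inv_S0[OF e_mem[OF i]] by simp
    then show "j i \<in> {..<card S\<^sub>0} \<and> j i \<noteq> i" using j(1)[OF i] by auto
  next
    show "inj_on j {..<card S\<^sub>0}"
    proof (rule inj_onI)
      fix i k assume ik: "i \<in> {..<card S\<^sub>0}" "k \<in> {..<card S\<^sub>0}" "j i = j k"
      then have "inv\<^bsub>G\<^esub> (e i) = inv\<^bsub>G\<^esub> (e k)" by (metis j(2) lessThan_iff)
      then have "e i = e k" using e_closed ik by (metis inv_inv lessThan_iff)
      then show "i = k" using e_inj ik by (meson inj_onD)
    qed
  next
    fix i M assume "i \<in> {..<card S\<^sub>0}"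
    then have i: "i < card S\<^sub>0" by simp
    have "word_coset (add_mset i (add_mset (j i) M)) = word_coset M #>\<^bsub>G\<^esub> e (j i) #>\<^bsub>G\<^esub> e i"
      using i j(1)[OF i] by (simp only: word_coset_add_mset)
    also have "\<dots> = H #>\<^bsub>G\<^esub> (word M \<otimes>\<^bsub>G\<^esub> (inv\<^bsub>G\<^esub> (e i) \<otimes>\<^bsub>G\<^esub> e i))"
      using i by (simp add: j(2) word_coset_def coset_mult_assoc H_sub word_closed e_closed m_assoc
          del: l_inv r_inv)
    also have "\<dots> = word_coset M"
      using e_closed[OF i] by (simp add: word_coset_def word_closed)
    finally show "word_coset (add_mset i (add_mset (j i) M)) = word_coset M" .
  qed
  then have ball: "card (Q.ball r) \<le> 2 ^ card S\<^sub>0 * ((r + p) choose r)" for r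
    by (simp add: p_def)
  \<comment> \<open>If \<open>p = 0\<close>, every ball has at most
    \<open>2 ^ card S\<^sub>0\<close> elements, so the group has order at most
    \<open>2 ^ card S\<close>; this contradicts the degree bound because
    \<open>\<kappa> * ln (ln n)\<close> exceeds \<open>ln 2\<close>.\<close>
  have p: "1 \<le> p"
  proof (rule ccontr)
    assume "\<not> 1 \<le> p"
    obtain r where "Q.ball r = rcosets\<^bsub>G\<^esub> H" using ex_ball_eq_rcosets by blast
    moreover have "p = 0" using \<open>\<not> 1 \<le> p\<close> by simp
    ultimately have "N \<le> 2 ^ card S\<^sub>0" using ball[of r] by (simp add: N_def)
    then have "real N \<le> 2 ^ card S\<^sub>0" by (metis of_nat_le_iff of_nat_numeral of_nat_power)
    then have "ln (real N) \<le> ln (2 ^ card S\<^sub>0)" using N by (subst ln_le_cancel_iff) auto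
    then have "ln (real N) \<le> real (card S\<^sub>0) * ln 2" by (simp add: ln_realpow)
    with lnN have le: "ln (real (order G)) \<le> real (card S) * ln 2"
      by (simp add: card_S distrib_right)
    with n have "0 < card S" by (cases "card S") auto
    then have "real (card S) * ln 2 < real (card S) * (\<kappa> * ln (ln (real (order G))))"
      using \<kappa> by simp
    with le deg show False by simp
  qed
  then have p': "card S\<^sub>0 \<le> 3 * p" "2 * p \<le> card S\<^sub>0" by (auto simp: p_def)
  \<comment> \<open>Rounding in \<open>p\<close> gives
    \<open>card S\<^sub>0 \<le> 2 * p + 1 \<le> 3 * p\<close>, which is where the base 8 comes
    from.\<close>
  have "2 ^ card S\<^sub>0 \<le> (2::nat) ^ (3 * p)" using p' by (intro power_increasing) auto
  also have "\<dots> = 8 ^ p" by (simp add: power_mult)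
  finally have "card (Q.ball r) \<le> 8 ^ p * ((r + p) choose r)" for r
    using ball[of r] by (meson le_trans mult_le_mono1)
  then have "real (cop_number (with_proj (Cay G S)) s)
      \<le> 48 * exp 1 * (real (order G) / real N powr (1 / real p))"
    unfolding N_def using p p' by (intro cop_number_bound) auto
  also have "\<dots> \<le> 48 * exp 1 * (real (order G) / ln (real (order G)) powr (2 * \<kappa>))"
  proof (intro mult_left_mono divide_left_mono)
    have "0 < ln (2::real)" by simp
    with \<kappa> have "0 \<le> L" unfolding L_def by linarith
    \<comment> \<open>Each involution costs at most \<open>ln 2\<close> in the logarithm of the
      index but saves \<open>L > ln 2\<close> in the degree term, so the passage to \<open>H\<close>
      loses nothing.\<close>
    then have "real (2 * p) * L \<le> real (card S\<^sub>0) * L"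
      using p'(2) by (intro mult_right_mono) (simp_all only: of_nat_le_iff)
    also have "\<dots> \<le> real (card S\<^sub>0) * L + real (card T) * (L - ln 2)"
      using \<kappa> by (simp add: L_def)
    also have "\<dots> = real (card S) * L - real (card T) * ln 2"
      by (simp add: card_S algebra_simps)
    also have "\<dots> \<le> ln (real N)" using deg lnN by (simp add: L_def)
    finally have "real p * (2 * \<kappa> * ln (ln (real (order G)))) \<le> ln (real N)"
      by (simp add: L_def mult_ac)
    then show "ln (real (order G)) powr (2 * \<kappa>) \<le> real N powr (1 / real p)"
      using n p N ord by (intro ln_powr_le_powr_inverse) auto
    show "0 < real N powr (1 / real p) * ln (real (order G)) powr (2 * \<kappa>)"
      using n N by simp
  qed auto
  finally show ?thesis .
qed

theorem corollary5p1:
  fixes \<kappa> :: real and \<F> :: "('a monoid \<times> 'a set) set"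
  assumes "\<kappa> > 0"
    and "\<And>G S. (G, S) \<in> \<F> \<Longrightarrow> abelian_cayley_datum G S"
    and "\<And>G S. (G, S) \<in> \<F> \<Longrightarrow> strongly_connected (with_proj (Cay G S))"
    and "\<exists>N::nat. \<forall>(G, S) \<in> \<F>. order G \<ge> N \<longrightarrow>
           real (card S) \<le> ln (real (order G)) / (\<kappa> * ln (ln (real (order G))))"
  shows "(\<forall>(G, S) \<in> \<F>. \<forall>s::nat. s \<ge> 1 \<longrightarrow>
            cop_number (with_proj (Cay G S)) (enat s) \<le> cop_number (with_proj (Cay G S)) \<infinity>) \<and>
         (\<exists>(C::real) (n0::nat). \<forall>(G, S) \<in> \<F>. order G \<ge> n0 \<longrightarrow>
            real (cop_number (with_proj (Cay G S)) \<infinity>)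
              \<le> C * (real (order G) / ln (real (order G)) powr \<kappa>)) \<and>
         (\<exists>(C::real) (n0::nat). \<forall>(G, S) \<in> \<F>. S = m_inv G ` S \<longrightarrow> order G \<ge> n0 \<longrightarrow>
            real (cop_number (with_proj (Cay G S)) \<infinity>)
              \<le> C * (real (order G) / ln (real (order G)) powr (2 * \<kappa>)))"
proof -
  have mono: "cop_number (with_proj (Cay G S)) (enat s) \<le> cop_number (with_proj (Cay G S)) \<infinity>"
    if "(G, S) \<in> \<F>" for G S s
    using assms(2)[OF that]
    by (intro cop_number_mono_speed) (auto simp: Cay_def abelian_cayley_datum_def)
  obtain N :: nat where N: "\<And>G S. (G, S) \<in> \<F> \<Longrightarrow> order G \<ge> N \<Longrightarrow>
      real (card S) \<le> ln (real (order G)) / (\<kappa> * ln (ln (real (order G))))"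
    using assms(4) by fast
  \<comment> \<open>The second inequality makes \<open>\<kappa> * ln (ln n)\<close> exceed
    \<open>ln 2\<close>. Its positivity permits clearing the denominator in the degree bound, and
    its size pays for the involutions in the symmetric case.\<close>
  obtain n1 :: nat where n1: "\<And>n. n \<ge> n1 \<Longrightarrow> 1 < ln (real n) \<and> ln 2 / \<kappa> < ln (ln (real n))"
    using eventually_ln_ln_ge[of "ln 2 / \<kappa>"] by blast
  have large: "1 < ln (real (order G))" "ln 2 < \<kappa> * ln (ln (real (order G)))"
    "real (card S) * (\<kappa> * ln (ln (real (order G)))) \<le> ln (real (order G))"
    if GS: "(G, S) \<in> \<F>" and n: "max N n1 \<le> order G" for G S
  proof -
    show "1 < ln (real (order G))" using n1[of "order G"] n by simp
    have "ln 2 / \<kappa> < ln (ln (real (order G)))" using n1[of "order G"] n by simp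
    then show L: "ln 2 < \<kappa> * ln (ln (real (order G)))"
      using \<open>\<kappa> > 0\<close> by (simp add: pos_divide_less_eq mult.commute)
    have "0 < \<kappa> * ln (ln (real (order G)))" using L ln_gt_zero[of "2::real"] by linarith
    moreover have "real (card S) \<le> ln (real (order G)) / (\<kappa> * ln (ln (real (order G))))"
      using N[OF GS] n by simp
    ultimately show "real (card S) * (\<kappa> * ln (ln (real (order G)))) \<le> ln (real (order G))"
      by (simp only: pos_le_divide_eq)
  qed
  show ?thesis
  proof (intro conjI exI[of _ "48 * exp 1"] exI[of _ "max N n1"]; intro ballI case_prodI2 allI impI)
    fix x G S and s :: nat
    assume "x \<in> \<F>" "x = (G, S)"
    then have "(G, S) \<in> \<F>" by simp
    then show "cop_number (with_proj (Cay G S)) (enat s) \<le> cop_number (with_proj (Cay G S)) \<infinity>"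
      by (rule mono)
  next
    fix x G S
    assume "x \<in> \<F>" "x = (G, S)" and n: "max N n1 \<le> order G"
    then have GS: "(G, S) \<in> \<F>" by simp
    show "real (cop_number (with_proj (Cay G S)) \<infinity>)
        \<le> 48 * exp 1 * (real (order G) / ln (real (order G)) powr \<kappa>)"
      by (rule cop_number_cayley_le[OF assms(2,3)[OF GS] large(1,3)[OF GS n]])
  next
    fix x G S
    assume "x \<in> \<F>" "x = (G, S)"
    then have GS: "(G, S) \<in> \<F>" by simp
    assume sym: "S = m_inv G ` S" and n: "max N n1 \<le> order G"
    show "real (cop_number (with_proj (Cay G S)) \<infinity>)
        \<le> 48 * exp 1 * (real (order G) / ln (real (order G)) powr (2 * \<kappa>))"
      by (rule cop_number_symmetric_cayley_le[OF assms(2,3)[OF GS] sym large[OF GS n]])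
  qed
qed

end
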